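(* Let $k$ be a field. For every given number $\alpha$, there are, up to isomorphism, only finitely many unsuspended homology spheres $\Delta$ (over $k$) with $\alpha(\Delta)=\alpha$.
   Context: A simplicial complex $\Delta$ on $n$ vertices is a family of subsets (faces) of a vertex set identified with $[n]=\{1,\dots,n\}$, closed under taking subsets, containing $\emptyset$ and all singletons $\{i\}$, $i\in[n]$. A minimal non-face of $\Delta$ is a set $M\subset[n]$ with $M\notin\Delta$ but $M\setminus\{i\}\in\Delta$ for every $i\in M$. If $\Delta$ is $(d-1)$-dimensional with $n$ vertices and $m$ minimal non-faces, then $\alpha(\Delta):=m-(n-d)$. A homology sphere (over $k$) is a $(d-1)$-dimensional simplicial complex, $d\ge 1$, such that for every face $F$ (including $F=\emptyset$) the link $\{S : S\cap F=\emptyset,\ S\cup F\in\Delta\}$ has the same reduced homology over $k$ as a sphere of dimension $d-1-|F|$. For a vertex $v$, the link is $lk_\Delta(v)=\{S\in\Delta : v\notin S,\ S\cup\{v\}\in\Delta\}$. The one-point suspension of $\Delta$ at a vertex $v$ is $\Sigma_{1,v}\Delta=\{S,\ S\cup\{v\},\ S\cup\{v'\} : v\notin S\in\Delta\}\cup\{S\cup\{v,v'\} : S\in lk_\Delta(v)\}$, where $v'$ is a new vertex. The two-point suspension is $\Sigma_2\Delta=\{S,\ S\cup\{w\},\ S\cup\{w'\} : S\in\Delta\}$, where $w,w'$ are two new vertices. A simplicial complex is called unsuspended if it cannot be obtained from another complex by an iterated application of operations $\Sigma_{1,v}$ and $\Sigma_2$. *)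

theory Defs
  imports Complex_Main
begin

section \<open>Finite abstract simplicial complexes\<close>

text \<open>
  Vertices are labelled by natural numbers. Since every singleton on a vertex is a face, the vertex
  set is the union of all faces and need not be carried around separately. The labels are not
  required to be an initial segment; complexes are compared through \<open>complex_iso\<close> below.
  The complex whose only face is the empty set is allowed (no vertices, dimension -1).
\<close>

type_synonym complx = "nat set set"

definition vertices :: "complx \<Rightarrow> nat set" where
  "vertices \<Delta> = \<Union>\<Delta>"

definition simplicial_complex :: "complx \<Rightarrow> bool" where
  "simplicial_complex \<Delta> \<longleftrightarrow>
     finite (vertices \<Delta>) \<and> {} \<in> \<Delta> \<and> (\<forall>F\<in>\<Delta>. \<forall>G. G \<subseteq> F \<longrightarrow> G \<in> \<Delta>)"

definition complex_iso :: "complx \<Rightarrow> complx \<Rightarrow> bool" where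
  "complex_iso \<Delta> \<Gamma> \<longleftrightarrow>
     (\<exists>f. bij_betw f (vertices \<Delta>) (vertices \<Gamma>) \<and> (\<lambda>F. f ` F) ` \<Delta> = \<Gamma>)"

text \<open>\<open>facet_card \<Delta>\<close> is the number \<open>d\<close> such that the complex is \<open>(d-1)\<close>-dimensional.\<close>

definition facet_card :: "complx \<Rightarrow> nat" where
  "facet_card \<Delta> = Max (card ` \<Delta>)"

definition minimal_nonfaces :: "complx \<Rightarrow> nat set set" where
  "minimal_nonfaces \<Delta> =
     {M. M \<subseteq> vertices \<Delta> \<and> M \<notin> \<Delta> \<and> (\<forall>i\<in>M. M - {i} \<in> \<Delta>)}"

definition alpha_inv :: "complx \<Rightarrow> int" where
  "alpha_inv \<Delta> =
     int (card (minimal_nonfaces \<Delta>)) - (int (card (vertices \<Delta>)) - int (facet_card \<Delta>))"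

definition face_link :: "complx \<Rightarrow> nat set \<Rightarrow> complx" where
  "face_link \<Delta> F = {S. S \<inter> F = {} \<and> S \<union> F \<in> \<Delta>}"


section \<open>Reduced simplicial homology with coefficients in a field\<close>

text \<open>
  An \<open>i\<close>-chain is a coefficient function on the faces with \<open>i + 1\<close> elements, extended by \<open>0\<close>;
  the empty face spans the chains of degree -1. Faces are oriented by the order of the vertex
  labels, so that removing the vertex \<open>v\<close> from \<open>F\<close> contributes with the sign \<open>(-1)^j\<close>,
  where \<open>j\<close> is the number of vertices of \<open>F\<close> smaller than \<open>v\<close>.
\<close>

definition chains :: "complx \<Rightarrow> int \<Rightarrow> (nat set \<Rightarrow> 'k::field) set" where
  "chains \<Delta> i = {c. \<forall>F. c F \<noteq> 0 \<longrightarrow> F \<in> \<Delta> \<and> int (card F) = i + 1}"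

definition boundary :: "complx \<Rightarrow> (nat set \<Rightarrow> 'k::field) \<Rightarrow> nat set \<Rightarrow> 'k" where
  "boundary \<Delta> c = (\<lambda>G. \<Sum>F\<in>\<Delta>. \<Sum>v\<in>F.
      if F - {v} = G then (-1) ^ card {u\<in>F. u < v} * c F else 0)"

definition cycles :: "complx \<Rightarrow> int \<Rightarrow> (nat set \<Rightarrow> 'k::field) set" where
  "cycles \<Delta> i = {c \<in> chains \<Delta> i. boundary \<Delta> c = (\<lambda>_. 0)}"

definition boundaries :: "complx \<Rightarrow> int \<Rightarrow> (nat set \<Rightarrow> 'k::field) set" where
  "boundaries \<Delta> i = boundary \<Delta> ` chains \<Delta> (i + 1)"

definition homologous ::
    "complx \<Rightarrow> int \<Rightarrow> ((nat set \<Rightarrow> 'k::field) \<times> (nat set \<Rightarrow> 'k)) set" where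
  "homologous \<Delta> i =
     {(c, c'). c \<in> cycles \<Delta> i \<and> c' \<in> cycles \<Delta> i \<and> (\<lambda>F. c F - c' F) \<in> boundaries \<Delta> i}"

definition reduced_homology :: "complx \<Rightarrow> int \<Rightarrow> (nat set \<Rightarrow> 'k::field) set set" where
  "reduced_homology \<Delta> i = cycles \<Delta> i // homologous \<Delta> i"

definition homology_add ::
    "complx \<Rightarrow> int \<Rightarrow> (nat set \<Rightarrow> 'k::field) set \<Rightarrow> (nat set \<Rightarrow> 'k) set \<Rightarrow> (nat set \<Rightarrow> 'k) set" where
  "homology_add \<Delta> i X Y = (\<Union>x\<in>X. \<Union>y\<in>Y. homologous \<Delta> i `` {\<lambda>F. x F + y F})"

definition homology_scale ::
    "complx \<Rightarrow> int \<Rightarrow> 'k \<Rightarrow> (nat set \<Rightarrow> 'k::field) set \<Rightarrow> (nat set \<Rightarrow> 'k) set" where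
  "homology_scale \<Delta> i a X = (\<Union>x\<in>X. homologous \<Delta> i `` {\<lambda>F. a * x F})"

definition homology_trivial :: "'k::field itself \<Rightarrow> complx \<Rightarrow> int \<Rightarrow> bool" where
  "homology_trivial _ \<Delta> i \<longleftrightarrow>
     (reduced_homology \<Delta> i :: (nat set \<Rightarrow> 'k) set set) = {homologous \<Delta> i `` {\<lambda>_. 0}}"

definition homology_iso_field :: "'k::field itself \<Rightarrow> complx \<Rightarrow> int \<Rightarrow> bool" where
  "homology_iso_field _ \<Delta> i \<longleftrightarrow>
     (\<exists>\<phi> :: (nat set \<Rightarrow> 'k) set \<Rightarrow> 'k.
        bij_betw \<phi> (reduced_homology \<Delta> i) UNIV \<and>
        (\<forall>X\<in>reduced_homology \<Delta> i. \<forall>Y\<in>reduced_homology \<Delta> i.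
           \<phi> (homology_add \<Delta> i X Y) = \<phi> X + \<phi> Y) \<and>
        (\<forall>a. \<forall>X\<in>reduced_homology \<Delta> i. \<phi> (homology_scale \<Delta> i a X) = a * \<phi> X))"

text \<open>
  The reduced homology of a sphere of dimension \<open>D \<ge> -1\<close> is the field in degree \<open>D\<close> and zero in
  every other degree; the sphere of dimension -1 is the complex whose only face is empty.
\<close>

definition has_homology_of_sphere :: "'k::field itself \<Rightarrow> complx \<Rightarrow> int \<Rightarrow> bool" where
  "has_homology_of_sphere K \<Delta> D \<longleftrightarrow>
     (\<forall>i. if i = D then homology_iso_field K \<Delta> i else homology_trivial K \<Delta> i)"

definition homology_sphere :: "'k::field itself \<Rightarrow> complx \<Rightarrow> bool" where
  "homology_sphere K \<Delta> \<longleftrightarrow>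
     simplicial_complex \<Delta> \<and> facet_card \<Delta> \<ge> 1 \<and>
     (\<forall>F\<in>\<Delta>. has_homology_of_sphere K (face_link \<Delta> F) (int (facet_card \<Delta>) - 1 - int (card F)))"


section \<open>Suspensions\<close>

definition one_point_suspension :: "complx \<Rightarrow> nat \<Rightarrow> nat \<Rightarrow> complx" where
  "one_point_suspension \<Delta> v v' =
     (\<Union>S\<in>{S\<in>\<Delta>. v \<notin> S}. {S, S \<union> {v}, S \<union> {v'}}) \<union> {S \<union> {v, v'} | S. S \<in> face_link \<Delta> {v}}"

definition two_point_suspension :: "complx \<Rightarrow> nat \<Rightarrow> nat \<Rightarrow> complx" where
  "two_point_suspension \<Delta> w w' = (\<Union>S\<in>\<Delta>. {S, S \<union> {w}, S \<union> {w'}})"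

text \<open>
  The new vertices may be any unused labels. Hence a complex isomorphic to a suspension of some
  complex is itself a suspension, namely of a relabelled copy, and \<open>unsuspended\<close> is invariant
  under isomorphism.
\<close>

inductive suspension_step :: "complx \<Rightarrow> complx \<Rightarrow> bool" where
  one_point: "\<lbrakk>simplicial_complex \<Delta>; v \<in> vertices \<Delta>; v' \<notin> vertices \<Delta>\<rbrakk>
    \<Longrightarrow> suspension_step \<Delta> (one_point_suspension \<Delta> v v')"
| two_point: "\<lbrakk>simplicial_complex \<Delta>; w \<notin> vertices \<Delta>; w' \<notin> vertices \<Delta>; w \<noteq> w'\<rbrakk>
    \<Longrightarrow> suspension_step \<Delta> (two_point_suspension \<Delta> w w')"

definition unsuspended :: "complx \<Rightarrow> bool" where
  "unsuspended \<Delta> \<longleftrightarrow> \<not> (\<exists>\<Gamma>. suspension_step\<^sup>+\<^sup>+ \<Gamma> \<Delta>)"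

end

theory Submission
  imports Defs
begin

text \<open>
  The complements of the faces of \<open>\<Delta>\<close> are the transversals of its minimal non-faces, and the
  homology of the links says that every inclusion-minimal transversal has size \<open>n - d\<close> (the link of
  a facet is \<open>{{}}\<close>) and that any new vertex can be exchanged into it (the link of a ridge has at
  least two vertices). Greedily collecting vertices that lie in two further non-faces yields
  \<open>K\<close> with at most \<open>2\<alpha>\<close> elements outside of which the non-faces are pairwise disjoint.
  If \<open>\<Delta>\<close> is unsuspended, each of the remaining ones meets a member of \<open>K\<close>, and the exchange
  property bounds how many there can be. Finally, distinct vertices of an unsuspended complex lie in
  distinct sets of minimal non-faces, so \<open>n \<le> 2 ^ m\<close>.
\<close>

section \<open>Hypergraphs with the exchange property\<close>

text \<open>A greedy choice suffices: when one more element is served, fewer than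
  \<open>card A\<close> values are taken, while its own set offers at least
  \<open>card A\<close>.\<close>

lemma inj_choice:
  assumes "finite A" and "\<And>x. x \<in> A \<Longrightarrow> finite (S x)" and "\<And>x. x \<in> A \<Longrightarrow> card A \<le> card (S x)"
  shows "\<exists>f. inj_on f A \<and> (\<forall>x\<in>A. f x \<in> S x)"
  using assms
proof (induction A rule: finite_induct)
  case (insert a A)
  then obtain f where f: "inj_on f A" "\<forall>x\<in>A. f x \<in> S x"
    by (metis Suc_leD card_insert_disjoint insertCI)
  have "card (f ` A) < card (S a)"
    using insert card_image_le[of A f] by (metis Suc_le_lessD card_insert_disjoint insertI1 le_trans not_less_eq_eq)
  then obtain y where y: "y \<in> S a" "y \<notin> f ` A"
    using insert.hyps(1) by (metis card_mono finite_imageI not_less subsetI)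
  have "inj_on (f(a := y)) (insert a A)"
    using f(1) y(2) insert.hyps(2) by (auto simp: inj_on_def)
  moreover have "\<forall>x\<in>insert a A. (f(a := y)) x \<in> S x" using f(2) y(1) by auto
  ultimately show ?case by blast
qed auto

text \<open>\<open>E\<close> models the minimal non-faces and \<open>c\<close> the codimension
  \<open>n - d\<close>, so transversals are complements of faces and those of size \<open>c\<close>
  are complements of facets. \<open>transversal_shrink\<close> then expresses purity, and
  \<open>exchange\<close> says that a facet can be left across any of its ridges.\<close>

locale exchange_hypergraph =
  fixes V :: "'a set" and E :: "'a set set" and c :: nat
  assumes finite_V: "finite V"
    and edge_subset: "M \<in> E \<Longrightarrow> M \<subseteq> V"
    and antichain: "M \<in> E \<Longrightarrow> L \<in> E \<Longrightarrow> M \<subseteq> L \<Longrightarrow> M = L"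
    and edge_nonempty: "M \<in> E \<Longrightarrow> M \<noteq> {}"
    and transversal_card: "X \<subseteq> V \<Longrightarrow> \<forall>M\<in>E. X \<inter> M \<noteq> {} \<Longrightarrow> c \<le> card X"
    and transversal_shrink: "X \<subseteq> V \<Longrightarrow> \<forall>M\<in>E. X \<inter> M \<noteq> {} \<Longrightarrow>
      \<exists>Y\<subseteq>X. (\<forall>M\<in>E. Y \<inter> M \<noteq> {}) \<and> card Y = c"
    and exchange: "X \<subseteq> V \<Longrightarrow> \<forall>M\<in>E. X \<inter> M \<noteq> {} \<Longrightarrow> card X = c \<Longrightarrow> y \<in> V - X \<Longrightarrow>
      \<exists>x\<in>X. \<forall>M\<in>E. (insert y X - {x}) \<inter> M \<noteq> {}"
begin

lemma finite_E: "finite E"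
  using finite_V edge_subset by (meson PowI finite_Pow_iff finite_subset subsetI)

text \<open>
  A smallest transversal meeting \<open>L0\<close> in a single point \<open>a\<close> of some \<open>M0 \<in> MM\<close> meets every member
  of \<open>MM\<close> exactly once. Exchanging in a point of \<open>M0 - L0\<close> then forces \<open>a\<close> out, and \<open>L0\<close> is missed.
\<close>

lemma no_representatives:
  assumes LL: "LL \<subseteq> E" and MM: "MM \<subseteq> E" and LM: "LL \<inter> MM = {}"
    and disj: "\<And>M M'. M \<in> MM \<Longrightarrow> M' \<in> E - LL \<Longrightarrow> M' \<noteq> M \<Longrightarrow> M \<inter> M' = {}"
    and L0: "L0 \<in> LL"
    and f: "inj_on f LL" "\<And>L. L \<in> LL \<Longrightarrow> f L \<in> MM \<and> f L \<inter> L \<noteq> {}"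
  shows False
proof -
  define M0 where "M0 = f L0"
  have M0: "M0 \<in> MM" "M0 \<inter> L0 \<noteq> {}" using f(2)[OF L0] by (auto simp: M0_def)
  then obtain a where a: "a \<in> M0" "a \<in> L0" by blast
  \<comment> \<open>An edge missed by this set would be a proper subset of \<open>L0\<close>.
    Shrinking the set gives a transversal \<open>Y\<close> of size \<open>c\<close> whose only point
    in \<open>L0\<close> is \<open>a\<close>.\<close>
  have "\<forall>M\<in>E. (V - (L0 - {a})) \<inter> M \<noteq> {}"
  proof
    fix M assume M: "M \<in> E"
    show "(V - (L0 - {a})) \<inter> M \<noteq> {}"
    proof
      assume "(V - (L0 - {a})) \<inter> M = {}"
      then have "M \<subseteq> L0 - {a}" using edge_subset[OF M] by blast
      then show False using antichain[OF M, of L0] L0 LL a by blast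
    qed
  qed
  then obtain Y where Y: "Y \<subseteq> V - (L0 - {a})" and YE: "\<forall>M\<in>E. Y \<inter> M \<noteq> {}" and cY: "card Y = c"
    using transversal_shrink[of "V - (L0 - {a})"] by blast
  have finY: "finite Y" using Y finite_V by (meson Diff_subset finite_subset)
  have YL0: "Y \<inter> L0 \<subseteq> {a}" using Y by blast
  then have aY: "a \<in> Y" using YE L0 LL by blast
  define U where "U = \<Union>MM"
  \<comment> \<open>One point is chosen from each member of \<open>MM\<close>; for
    \<open>M = f L\<close> it is taken in \<open>L\<close> as well. So at most
    \<open>card MM\<close> points hit all of \<open>LL\<close> and \<open>MM\<close> at once.
    Injectivity of \<open>f\<close> makes \<open>L\<close> recoverable from
    \<open>M\<close>.\<close>
  define g where "g M = (if M \<in> f ` LL then SOME x. x \<in> M \<inter> inv_into LL f M else SOME x. x \<in> M)" for M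
  have gf: "g (f L) \<in> f L \<inter> L" if "L \<in> LL" for L
  proof -
    have "g (f L) = (SOME x. x \<in> f L \<inter> L)"
      using that f(1) by (simp add: g_def)
    then show ?thesis using f(2)[OF that] by (metis ex_in_conv someI_ex)
  qed
  have gM: "g M \<in> M" if "M \<in> MM" for M
  proof (cases "M \<in> f ` LL")
    case True then show ?thesis using gf by blast
  next
    case False
    then show ?thesis using edge_nonempty[of M] that MM by (simp add: g_def) (metis ex_in_conv someI_ex subsetD)
  qed
  have finMM: "finite MM" using MM finite_E finite_subset by blast
  have trans: "\<forall>M\<in>E. (W \<union> g ` MM) \<inter> M \<noteq> {}"
    if W: "\<And>M. M \<in> E - LL - MM \<Longrightarrow> W \<inter> M \<noteq> {}" for W
  proof
    fix M assume "M \<in> E"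
    then consider "M \<in> LL" | "M \<in> MM" | "M \<in> E - LL - MM" by blast
    then show "(W \<union> g ` MM) \<inter> M \<noteq> {}"
    proof cases
      case 1 then show ?thesis using gf[of M] f(2)[of M] by blast
    next
      case 2 then show ?thesis using gM by blast
    next
      case 3 then show ?thesis using W by blast
    qed
  qed
  have gV: "g ` MM \<subseteq> V" using gM MM edge_subset by blast
  have RU: "M \<inter> U = {}" if "M \<in> E - LL - MM" for M
    using that disj unfolding U_def by blast
  \<comment> \<open>Together with the points chosen by \<open>g\<close>, any part \<open>W\<close>
    of \<open>Y\<close> that hits the remaining edges is a transversal.\<close>
  have bound: "c \<le> card W + card MM"
    if "W \<subseteq> Y" and "\<And>M. M \<in> E - LL - MM \<Longrightarrow> W \<inter> M \<noteq> {}" for W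
  proof -
    have "c \<le> card (W \<union> g ` MM)"
      using trans[OF that(2)] gV that(1) Y by (intro transversal_card) auto
    also have "\<dots> \<le> card W + card (g ` MM)" by (rule card_Un_le)
    finally show ?thesis using card_image_le[OF finMM, of g] by simp
  qed
  have hitR: "(Y - U) \<inter> M \<noteq> {}" if "M \<in> E - LL - MM" for M
    using that RU[OF that] YE by blast
  \<comment> \<open>The remaining edges avoid \<open>U\<close>, so \<open>Y - U\<close> can serve as
    \<open>W\<close>, and at most \<open>card MM\<close> points of \<open>Y\<close> lie in
    \<open>U\<close>. The members of \<open>MM\<close> are pairwise disjoint and all hit by
    \<open>Y\<close>, hence each contains exactly one point of \<open>Y\<close>.\<close>
  have "card Y = card (Y - U) + card (Y \<inter> U)"
    using finY by (metis Int_Diff_Un Int_Diff_disjoint add.commute card_Un_disjoint finite_Diff finite_Int)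
  then have le: "card (Y \<inter> U) \<le> card MM"
    and cYU: "c = card (Y - U) + card (Y \<inter> U)"
    using bound[of "Y - U"] hitR cY by auto
  have "Y \<inter> U = (\<Union>M\<in>MM. Y \<inter> M)" unfolding U_def by blast
  moreover have "card (\<Union>M\<in>MM. Y \<inter> M) = (\<Sum>M\<in>MM. card (Y \<inter> M))"
  proof (rule card_UN_disjoint[OF finMM])
    show "\<forall>M\<in>MM. \<forall>M'\<in>MM. M \<noteq> M' \<longrightarrow> Y \<inter> M \<inter> (Y \<inter> M') = {}"
    proof (intro ballI impI)
      fix M M' assume "M \<in> MM" "M' \<in> MM" "M \<noteq> M'"
      then show "Y \<inter> M \<inter> (Y \<inter> M') = {}" using disj[of M M'] MM LM by blast
    qed
  qed (use finY in simp)
  ultimately have sum: "card (Y \<inter> U) = (\<Sum>M\<in>MM. card (Y \<inter> M))" by simp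
  have pos: "1 \<le> card (Y \<inter> M)" if "M \<in> MM" for M
    using that YE MM finY by (metis Suc_leI One_nat_def card_gt_0_iff finite_Int subsetD)
  have one: "card (Y \<inter> M) = 1" if M: "M \<in> MM" for M
  proof (rule ccontr)
    assume "card (Y \<inter> M) \<noteq> 1"
    then have "1 < card (Y \<inter> M)" using pos[OF M] by simp
    then have "(\<Sum>M\<in>MM. 1) < (\<Sum>M\<in>MM. card (Y \<inter> M))"
      using pos M by (intro sum_strict_mono_ex1[OF finMM]) auto
    then show False using le sum by simp
  qed
  have uniq: "x = x'" if "M \<in> MM" "x \<in> Y \<inter> M" "x' \<in> Y \<inter> M" for x x' M
    using one[OF that(1)] that(2,3) by (metis card_1_singletonE singletonD)
  have "card (Y \<inter> U) = card MM" using sum one by simp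
  then have cYU': "c = card (Y - U) + card MM" using cYU by simp
  obtain y where y: "y \<in> M0" "y \<notin> L0"
    using antichain[of M0 L0] M0 L0 LL MM LM by blast
  have "y \<notin> Y" using uniq[OF M0(1), of y a] y a aY by blast
  moreover have "y \<in> V" using y M0 MM edge_subset by blast
  ultimately obtain x where x: "x \<in> Y" and ex: "\<forall>M\<in>E. (insert y Y - {x}) \<inter> M \<noteq> {}"
    using exchange[of Y y] Y YE cY by blast
  \<comment> \<open>If \<open>a\<close> left, the new transversal would have no point in
    \<open>L0\<close>, since \<open>y\<close> lies outside \<open>L0\<close>.\<close>
  have "x \<noteq> a"
    using bspec[OF ex, of L0] L0 LL YL0 y by auto
  \<comment> \<open>If \<open>x\<close> lies in \<open>U\<close>, its member of \<open>MM\<close> is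
    not \<open>M0\<close>, does not contain \<open>y\<close>, and loses its only point. Otherwise
    \<open>Y - U - {x}\<close> still hits the remaining edges, which \<open>y\<close> cannot reach,
    and is too small for \<open>bound\<close>.\<close>
  show False
  proof (cases "x \<in> U")
    case True
    then obtain M where M: "M \<in> MM" "x \<in> M" unfolding U_def by blast
    then have "M \<noteq> M0" using uniq[of M x a] x a aY \<open>x \<noteq> a\<close> by blast
    then have "y \<notin> M" using disj[of M M0] M M0 MM LM y by blast
    then have "(insert y Y - {x}) \<inter> M = {}" using uniq[OF M(1), of x] M x by blast
    then show False using ex M MM by blast
  next
    case False
    have "y \<in> U" using y M0 unfolding U_def by blast
    have "(Y - U - {x}) \<inter> M \<noteq> {}" if "M \<in> E - LL - MM" for M
      using that ex RU[OF that] \<open>y \<in> U\<close> by blast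
    then have "c \<le> card (Y - U - {x}) + card MM" by (intro bound) auto
    moreover have "card (Y - U - {x}) < card (Y - U)"
      using x False finY by (intro psubset_card_mono) auto
    ultimately show False using cYU' by simp
  qed
qed

text \<open>If every \<open>L\<close> in \<open>LL\<close> met at least \<open>card LL\<close>
  members of \<open>MM\<close>, distinct representatives could be chosen, which
  \<open>no_representatives\<close> excludes. So some \<open>L\<close> meets fewer than
  \<open>card LL\<close>, hence at most \<open>N\<close>, members; these are removed together with
  \<open>L\<close>. The separate bound \<open>N\<close> stays fixed while \<open>LL\<close>
  shrinks.\<close>

lemma card_sparse_edges_le:
  assumes "LL \<subseteq> E" "MM \<subseteq> E" "LL \<inter> MM = {}" "card LL \<le> N"
    and "\<And>M M'. M \<in> MM \<Longrightarrow> M' \<in> E - LL \<Longrightarrow> M' \<noteq> M \<Longrightarrow> M \<inter> M' = {}"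
    and "\<And>M. M \<in> MM \<Longrightarrow> \<exists>L\<in>LL. M \<inter> L \<noteq> {}"
  shows "card MM \<le> card LL * N"
  using assms
proof (induction "card LL" arbitrary: LL MM)
  case 0
  then have "LL = {}" using finite_E finite_subset by (metis card_0_eq)
  then show ?case using 0 by (metis card.empty empty_iff equals0I le0)
next
  case (Suc t)
  note LL = Suc.prems(1) and MM = Suc.prems(2) and disj = Suc.prems(5) and meet = Suc.prems(6)
  have fin: "finite LL" "finite MM" using LL MM finite_E finite_subset by blast+
  define S where "S L = {M\<in>MM. M \<inter> L \<noteq> {}}" for L
  have finS: "finite (S L)" for L using fin by (simp add: S_def)
  have "\<exists>L\<in>LL. card (S L) < card LL"
  proof (rule ccontr)
    assume "\<not> ?thesis"
    then obtain f where "inj_on f LL" "\<forall>L\<in>LL. f L \<in> S L"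
      using inj_choice[OF fin(1), of S] finS by (auto simp: not_less)
    moreover obtain L0 where "L0 \<in> LL" using Suc.hyps(2) by fastforce
    ultimately show False
      using no_representatives[OF LL MM Suc.prems(3) disj, of L0 f] by (auto simp: S_def)
  qed
  then obtain L where L: "L \<in> LL" "card (S L) \<le> N" using Suc.prems(4) by force
  have t: "t = card (LL - {L})" using Suc.hyps(2) L fin by simp
  have "card (MM - S L) \<le> card (LL - {L}) * N"
  proof (rule Suc.hyps(1)[OF t])
    show "card (LL - {L}) \<le> N" using t Suc.hyps(2) Suc.prems(4) by simp
    \<comment> \<open>Dropping \<open>L\<close> from \<open>LL\<close> puts it among the outside
      edges, but the members of \<open>MM\<close> that are kept are exactly those disjoint from
      \<open>L\<close>.\<close>
    show "M \<inter> M' = {}" if "M \<in> MM - S L" "M' \<in> E - (LL - {L})" "M' \<noteq> M" for M M'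
      using that disj[of M M'] by (cases "M' = L") (auto simp: S_def)
    show "\<exists>L'\<in>LL - {L}. M \<inter> L' \<noteq> {}" if "M \<in> MM - S L" for M
      using that meet[of M] by (auto simp: S_def)
  qed (use LL MM Suc.prems(3) in auto)
  moreover have "card MM \<le> card (MM - S L) + card (S L)"
    using fin finS by (metis Un_Diff_cancel2 card_Un_le card_mono finite_UnI le_trans sup_ge1)
  ultimately show ?case using L(2) t Suc.hyps(2)[symmetric] by simp
qed

text \<open>A largest family \<open>K\<close> that can be hit with at most half as many points as it
  has members leaves pairwise disjoint edges outside. Adding one point per outside edge gives a
  transversal, so \<open>c\<close> is at most \<open>card K / 2 + card (E - K)\<close>; compared
  with \<open>card E \<le> c + a\<close> this yields \<open>card K \<le> 2 * a\<close>. The outside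
  edges are then counted by \<open>card_sparse_edges_le\<close>.\<close>

lemma card_edges_le:
  assumes deviation: "card E \<le> c + a"
    and meet: "\<And>M. M \<in> E \<Longrightarrow> \<exists>L\<in>E. L \<noteq> M \<and> M \<inter> L \<noteq> {}"
  shows "card E \<le> 2 * a + 2 * a * (2 * a)"
proof -
  define good where "good K \<longleftrightarrow> K \<subseteq> E \<and> (\<exists>W\<subseteq>V. 2 * card W \<le> card K \<and> (\<forall>M\<in>K. W \<inter> M \<noteq> {}))" for K
  have "good {}" unfolding good_def by (intro conjI exI[of _ "{}"]) simp_all
  moreover have "\<forall>K. good K \<longrightarrow> card K < Suc (card E)"
    using finite_E by (auto simp: good_def card_mono less_Suc_eq_le)
  ultimately obtain K where "good K" and maxK: "\<And>K'. good K' \<Longrightarrow> card K' \<le> card K"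
    using ex_has_greatest_nat[of good "{}" card "Suc (card E)"] by blast
  then obtain W where K: "K \<subseteq> E" and W: "W \<subseteq> V" "2 * card W \<le> card K" "\<forall>M\<in>K. W \<inter> M \<noteq> {}"
    by (auto simp: good_def)
  have finK: "finite K" using K finite_E finite_subset by blast
  have disj: "M \<inter> M' = {}" if "M \<in> E - K" "M' \<in> E - K" "M' \<noteq> M" for M M'
  proof (rule ccontr)
    \<comment> \<open>A common point \<open>v\<close> would hit two further edges at the cost of one
      point, contradicting the maximality of \<open>K\<close>.\<close>
    assume "M \<inter> M' \<noteq> {}"
    then obtain v where v: "v \<in> M" "v \<in> M'" by blast
    let ?K = "insert M (insert M' K)"
    have card: "card ?K = card K + 2" using that finK by simp
    have "card (insert v W) \<le> Suc (card W)" 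
      using finite_subset[OF W(1) finite_V] by (simp add: card_insert_if)
    then have "2 * card (insert v W) \<le> card ?K" using card W(2) by linarith
    moreover have "insert v W \<subseteq> V" using v that(1) edge_subset[of M] W(1) by auto
    moreover have "\<forall>L\<in>?K. insert v W \<inter> L \<noteq> {}" using v W(3) by auto
    moreover have "?K \<subseteq> E" using that K by auto
    ultimately have "good ?K" unfolding good_def by blast
    then show False using maxK[of ?K] card by simp
  qed
  define p where "p M = (SOME x. x \<in> M)" for M :: "'a set"
  have p: "p M \<in> M" if "M \<in> E" for M
    using edge_nonempty[OF that] by (metis p_def ex_in_conv someI_ex)
  have "c \<le> card (W \<union> p ` (E - K))"
  proof (rule transversal_card)
    show "W \<union> p ` (E - K) \<subseteq> V" using W p edge_subset by blast
    show "\<forall>M\<in>E. (W \<union> p ` (E - K)) \<inter> M \<noteq> {}" using W p by blast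
  qed
  also have "\<dots> \<le> card W + card (E - K)"
    using card_Un_le[of W "p ` (E - K)"] card_image_le[of "E - K" p] finite_E by simp
  finally have "c \<le> card W + card (E - K)" .
  moreover have E: "card E = card K + card (E - K)"
    using K finite_E by (simp add: card_Diff_subset card_mono finK)
  ultimately have K2: "card K \<le> 2 * a" using deviation W(2) by linarith
  have "card (E - K) \<le> card K * (2 * a)"
  proof (rule card_sparse_edges_le[OF K])
    \<comment> \<open>The other edge that meets \<open>M\<close> must lie in \<open>K\<close>,
      because edges outside \<open>K\<close> are disjoint.\<close>
    show "\<exists>L\<in>K. M \<inter> L \<noteq> {}" if "M \<in> E - K" for M
      using meet[of M] disj[OF that] that by blast
  qed (use K2 disj in auto)
  also have "\<dots> \<le> 2 * a * (2 * a)" using K2 by simp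
  finally show ?thesis using E K2 by simp
qed

end


section \<open>Minimal non-faces and suspensions\<close>

lemma complex_subset: "simplicial_complex \<Delta> \<Longrightarrow> F \<in> \<Delta> \<Longrightarrow> G \<subseteq> F \<Longrightarrow> G \<in> \<Delta>"
  by (auto simp: simplicial_complex_def)

lemma complex_finite: "simplicial_complex \<Delta> \<Longrightarrow> finite \<Delta>"
  unfolding simplicial_complex_def vertices_def by (meson finite_UnionD)

lemma face_subset_vertices: "F \<in> \<Delta> \<Longrightarrow> F \<subseteq> vertices \<Delta>"
  by (auto simp: vertices_def)

lemma face_finite: "simplicial_complex \<Delta> \<Longrightarrow> F \<in> \<Delta> \<Longrightarrow> finite F"
  using finite_subset[OF face_subset_vertices, of F \<Delta>] unfolding simplicial_complex_def by blast

lemma vertex_face: "simplicial_complex \<Delta> \<Longrightarrow> v \<in> vertices \<Delta> \<Longrightarrow> {v} \<in> \<Delta>"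
  using complex_subset by (fastforce simp: vertices_def)

lemma nonface_contains_minimal:
  assumes "simplicial_complex \<Delta>" "S \<subseteq> vertices \<Delta>" "S \<notin> \<Delta>"
  shows "\<exists>M\<in>minimal_nonfaces \<Delta>. M \<subseteq> S"
proof -
  have "finite S" using assms finite_subset by (auto simp: simplicial_complex_def)
  then show ?thesis
    using assms(2,3)
  proof (induction S rule: finite_psubset_induct)
    case (psubset S)
    show ?case
    proof (cases "\<forall>i\<in>S. S - {i} \<in> \<Delta>")
      case True
      then show ?thesis using psubset by (auto simp: minimal_nonfaces_def)
    next
      case False
      then obtain i where "i \<in> S" "S - {i} \<notin> \<Delta>" by blast
      then show ?thesis using psubset.IH[of "S - {i}"] psubset.prems by blast
    qed
  qed
qed

lemma minimal_nonface_antichain: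
  assumes "simplicial_complex \<Delta>" "M \<in> minimal_nonfaces \<Delta>" "L \<in> minimal_nonfaces \<Delta>" "M \<subseteq> L"
  shows "M = L"
proof (rule ccontr)
  assume "M \<noteq> L"
  then obtain i where "i \<in> L" "M \<subseteq> L - {i}" using assms(4) by blast
  then have "L - {i} \<in> \<Delta>" using assms(3) by (simp add: minimal_nonfaces_def)
  then have "M \<in> \<Delta>" using complex_subset[OF assms(1)] \<open>M \<subseteq> L - {i}\<close> by blast
  then show False using assms(2) by (simp add: minimal_nonfaces_def)
qed

text \<open>A set of vertices is a non-face exactly when it contains a minimal non-face, and
  \<open>X\<close> misses \<open>M\<close> exactly when the complement of \<open>X\<close> contains
  \<open>M\<close>. This is the dictionary between faces and transversals.\<close>

lemma face_iff_transversal: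
  assumes "simplicial_complex \<Delta>" "X \<subseteq> vertices \<Delta>"
  shows "vertices \<Delta> - X \<in> \<Delta> \<longleftrightarrow> (\<forall>M\<in>minimal_nonfaces \<Delta>. X \<inter> M \<noteq> {})"
proof
  assume face: "vertices \<Delta> - X \<in> \<Delta>"
  show "\<forall>M\<in>minimal_nonfaces \<Delta>. X \<inter> M \<noteq> {}"
  proof (intro ballI notI)
    fix M assume M: "M \<in> minimal_nonfaces \<Delta>" "X \<inter> M = {}"
    then have "M \<subseteq> vertices \<Delta> - X" by (auto simp: minimal_nonfaces_def)
    then show False using complex_subset[OF assms(1) face] M(1) by (simp add: minimal_nonfaces_def)
  qed
next
  assume hit: "\<forall>M\<in>minimal_nonfaces \<Delta>. X \<inter> M \<noteq> {}"
  show "vertices \<Delta> - X \<in> \<Delta>"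
  proof (rule ccontr)
    assume "vertices \<Delta> - X \<notin> \<Delta>"
    then obtain M where "M \<in> minimal_nonfaces \<Delta>" "M \<subseteq> vertices \<Delta> - X"
      using nonface_contains_minimal[OF assms(1) Diff_subset] by blast
    then show False using hit by blast
  qed
qed

text \<open>Twins \<open>v\<close> and \<open>v'\<close> come from a single suspension step: a
  one-point suspension of the link of \<open>v'\<close> if \<open>{v, v'}\<close> is a face, and
  otherwise a two-point suspension of the subcomplex avoiding both.\<close>

lemma twin_vertices_suspended:
  assumes sc: "simplicial_complex \<Delta>" and v: "v \<in> vertices \<Delta>" "v' \<in> vertices \<Delta>" "v \<noteq> v'"
    and twins: "\<And>M. M \<in> minimal_nonfaces \<Delta> \<Longrightarrow> v \<in> M \<longleftrightarrow> v' \<in> M"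
  shows "\<not> unsuspended \<Delta>"
proof -
  \<comment> \<open>A face without one twin can be enlarged by the other: a minimal non-face created
    by adding \<open>u\<close> avoids \<open>u'\<close>, hence also its twin \<open>u\<close>, and
    would lie in \<open>S\<close> already.\<close>
  have add: "insert u S \<in> \<Delta>"
    if "S \<in> \<Delta>" "u' \<notin> S" "(u, u') = (v, v') \<or> (u, u') = (v', v)" for S u u'
  proof (rule ccontr)
    assume "insert u S \<notin> \<Delta>"
    moreover have "insert u S \<subseteq> vertices \<Delta>" using that v face_subset_vertices by blast
    ultimately obtain M where M: "M \<in> minimal_nonfaces \<Delta>" "M \<subseteq> insert u S"
      using nonface_contains_minimal[OF sc] by blast
    have "u' \<notin> M" using M(2) that v(3) by blast
    then have "u \<notin> M" using twins[OF M(1)] that(3) by auto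
    then have "M \<subseteq> S" using M(2) by blast
    then show False using complex_subset[OF sc that(1)] M(1) by (auto simp: minimal_nonfaces_def)
  qed
  have "\<exists>\<Gamma>. suspension_step \<Gamma> \<Delta>"
  proof (cases "{v, v'} \<in> \<Delta>")
    case True
    \<comment> \<open>In a one-point suspension the link of the new vertex is the original complex,
      so this is the only candidate.\<close>
    define \<Gamma> where "\<Gamma> = face_link \<Delta> {v'}"
    have \<Gamma>: "S \<in> \<Gamma> \<longleftrightarrow> v' \<notin> S \<and> insert v' S \<in> \<Delta>" for S by (auto simp: \<Gamma>_def face_link_def)
    have \<Gamma>\<Delta>: "S \<in> \<Delta>" if "S \<in> \<Gamma>" for S
      using that complex_subset[OF sc, of "insert v' S" S] by (auto simp: \<Gamma>)
    have sub: "vertices \<Gamma> \<subseteq> vertices \<Delta>" using \<Gamma>\<Delta> by (auto simp: vertices_def)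
    have sc\<Gamma>: "simplicial_complex \<Gamma>"
      unfolding simplicial_complex_def
    proof (intro conjI ballI allI impI)
      show "finite (vertices \<Gamma>)" using sub sc finite_subset by (auto simp: simplicial_complex_def)
      show "{} \<in> \<Gamma>" using vertex_face[OF sc v(2)] by (simp add: \<Gamma>)
      show "G \<in> \<Gamma>" if "F \<in> \<Gamma>" "G \<subseteq> F" for F G
        using that complex_subset[OF sc, of "insert v' F" "insert v' G"] by (auto simp: \<Gamma>)
    qed
    have "{v} \<in> \<Gamma>" using True v(3) by (simp add: \<Gamma> insert_commute)
    then have "v \<in> vertices \<Gamma>" by (auto simp: vertices_def)
    moreover have "v' \<notin> vertices \<Gamma>" by (auto simp: vertices_def \<Gamma>)
    moreover have "one_point_suspension \<Gamma> v v' = \<Delta>"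
    proof (intro equalityI subsetI)
      fix T assume "T \<in> one_point_suspension \<Gamma> v v'"
      then consider S where "S \<in> \<Gamma>" "v \<notin> S" "T = S \<or> T = insert v S \<or> T = insert v' S"
        | S where "S \<in> face_link \<Gamma> {v}" "T = S \<union> {v, v'}"
        by (auto simp: one_point_suspension_def)
      then show "T \<in> \<Delta>"
      proof cases
        case 1 then show ?thesis using \<Gamma>\<Delta> \<Gamma> add[of S v' v] by auto
      next
        case 2
        then have "insert v' (insert v S) \<in> \<Delta>" by (simp add: face_link_def \<Gamma>)
        moreover have "T = insert v' (insert v S)" using 2 by blast
        ultimately show ?thesis by simp
      qed
    next
      fix T assume T: "T \<in> \<Delta>"
      define S where "S = T - {v, v'}"
      have "S \<in> \<Delta>" using complex_subset[OF sc T] by (auto simp: S_def)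
      then have S: "S \<in> \<Gamma>" "v \<notin> S" "v' \<notin> S" using add[of S v v'] by (auto simp: \<Gamma> S_def)
      consider "T = S" | "T = S \<union> {v}" | "T = S \<union> {v'}" | "T = S \<union> {v, v'}" by (auto simp: S_def)
      then show "T \<in> one_point_suspension \<Gamma> v v'"
      proof cases
        case 4
        then have "insert v' (insert v S) \<in> \<Delta>" using T by (simp add: insert_commute)
        then have "S \<in> face_link \<Gamma> {v}" using S v(3) by (auto simp: face_link_def \<Gamma>)
        then show ?thesis using 4 by (auto simp: one_point_suspension_def)
      qed (use S in \<open>auto simp: one_point_suspension_def\<close>)
    qed
    ultimately show ?thesis using one_point[OF sc\<Gamma>, of v v'] by auto
  next
    case False
    define \<Gamma> where "\<Gamma> = {S\<in>\<Delta>. v \<notin> S \<and> v' \<notin> S}"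
    have sub: "vertices \<Gamma> \<subseteq> vertices \<Delta>" by (auto simp: vertices_def \<Gamma>_def)
    have "simplicial_complex \<Gamma>"
      using sc sub finite_subset unfolding simplicial_complex_def \<Gamma>_def by blast
    moreover have "v \<notin> vertices \<Gamma>" "v' \<notin> vertices \<Gamma>" by (auto simp: vertices_def \<Gamma>_def)
    moreover have "two_point_suspension \<Gamma> v v' = \<Delta>"
    proof (intro equalityI subsetI)
      fix T assume "T \<in> two_point_suspension \<Gamma> v v'"
      then show "T \<in> \<Delta>" using add[of _ v' v] add[of _ v v'] by (auto simp: two_point_suspension_def \<Gamma>_def)
    next
      fix T assume T: "T \<in> \<Delta>"
      define S where "S = T - {v, v'}"
      have S: "S \<in> \<Gamma>" using complex_subset[OF sc T] by (auto simp: S_def \<Gamma>_def)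
      have "\<not> {v, v'} \<subseteq> T" using False complex_subset[OF sc T] by blast
      then have "T = S \<or> T = S \<union> {v} \<or> T = S \<union> {v'}" by (auto simp: S_def)
      then show "T \<in> two_point_suspension \<Gamma> v v'" using S by (auto simp: two_point_suspension_def)
    qed
    ultimately show ?thesis using two_point[of \<Gamma> v v'] v(3) by auto
  qed
  then show ?thesis by (auto simp: unsuspended_def)
qed

text \<open>A minimal non-face has at least two vertices, because the empty set and the singletons
  are faces. If it were disjoint from all others, any two of its vertices would be twins.\<close>

lemma unsuspended_nonface_meets_another:
  assumes sc: "simplicial_complex \<Delta>" and "unsuspended \<Delta>" and M: "M \<in> minimal_nonfaces \<Delta>"
  shows "\<exists>L\<in>minimal_nonfaces \<Delta>. L \<noteq> M \<and> M \<inter> L \<noteq> {}"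
proof (rule ccontr)
  assume iso: "\<not> ?thesis"
  have MV: "M \<subseteq> vertices \<Delta>" "M \<notin> \<Delta>" using M by (auto simp: minimal_nonfaces_def)
  then obtain v where v: "v \<in> M" using sc by (metis equals0I simplicial_complex_def)
  have "M \<noteq> {v}" using MV vertex_face[OF sc, of v] v by blast
  then obtain v' where v': "v' \<in> M" "v \<noteq> v'" using v by blast
  have "v \<in> L \<longleftrightarrow> v' \<in> L" if "L \<in> minimal_nonfaces \<Delta>" for L
    using iso that v v' by blast
  then show False using twin_vertices_suspended[OF sc, of v v'] v v' MV assms(2) by blast
qed

lemma minimal_nonfaces_finite: "simplicial_complex \<Delta> \<Longrightarrow> finite (minimal_nonfaces \<Delta>)"
  by (rule finite_subset[of _ "Pow (vertices \<Delta>)"]) (auto simp: minimal_nonfaces_def simplicial_complex_def)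

text \<open>Without twins, a vertex is determined by the set of minimal non-faces containing
  it.\<close>

lemma unsuspended_card_vertices_le:
  assumes sc: "simplicial_complex \<Delta>" and "unsuspended \<Delta>"
  shows "card (vertices \<Delta>) \<le> 2 ^ card (minimal_nonfaces \<Delta>)"
proof -
  let ?h = "\<lambda>v. {M \<in> minimal_nonfaces \<Delta>. v \<in> M}"
  have "inj_on ?h (vertices \<Delta>)"
  proof (rule inj_onI, rule ccontr)
    fix v v' assume "v \<in> vertices \<Delta>" "v' \<in> vertices \<Delta>" "?h v = ?h v'" "v \<noteq> v'"
    moreover from this(3) have "v \<in> M \<longleftrightarrow> v' \<in> M" if "M \<in> minimal_nonfaces \<Delta>" for M
      using that by blast
    ultimately show False using twin_vertices_suspended[OF sc, of v v'] assms(2) by simp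
  qed
  moreover have "?h ` vertices \<Delta> \<subseteq> Pow (minimal_nonfaces \<Delta>)" by auto
  ultimately have "card (vertices \<Delta>) \<le> card (Pow (minimal_nonfaces \<Delta>))"
    using minimal_nonfaces_finite[OF sc] by (intro card_inj_on_le[of ?h]) simp_all
  then show ?thesis using minimal_nonfaces_finite[OF sc] by (simp add: card_Pow)
qed


section \<open>Facets and ridges of homology spheres\<close>

text \<open>The empty face is a nonzero cycle in degree -1, and without vertices there is no nonzero
  boundary to kill it.\<close>

lemma not_homology_trivial_empty_face:
  "\<not> homology_trivial TYPE('k::field) {{}} (-1)"
proof
  assume *: "homology_trivial TYPE('k) {{}} (-1)"
  define e :: "nat set \<Rightarrow> 'k" where "e F = (if F = {} then 1 else 0)" for F
  have b0: "boundary {{}} x = (\<lambda>_. 0)" for x :: "nat set \<Rightarrow> 'k"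
    by (simp add: boundary_def)
  have "(\<lambda>_. 0) \<in> chains {{}} 0" by (simp add: chains_def)
  then have bd: "boundaries {{}} (-1) = {\<lambda>_. 0 :: 'k}"
    using b0 by (auto simp: boundaries_def image_iff)
  have e: "e \<in> cycles {{}} (-1)" by (auto simp: cycles_def b0 chains_def e_def)
  then have "homologous {{}} (-1) `` {e} \<in> reduced_homology {{}} (-1)"
    by (auto simp: reduced_homology_def quotient_def)
  then have "homologous {{}} (-1) `` {e} = homologous {{}} (-1) `` {\<lambda>_. 0 :: 'k}"
    using * by (simp add: homology_trivial_def)
  moreover have "e \<in> homologous {{}} (-1) `` {e}" using e by (simp add: homologous_def bd)
  ultimately have "(\<lambda>_. 0, e) \<in> homologous {{}} (-1)" by blast
  then have "(\<lambda>F. 0 - e F) = (\<lambda>_. 0)" by (simp add: homologous_def bd)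
  then have "0 - e {} = 0" by meson
  then show False by (simp add: e_def)
qed

text \<open>If \<open>y\<close> were the only possible vertex, a 0-cycle would be a multiple of
  \<open>{y}\<close> whose boundary has the same coefficient at the empty face, hence zero. A single
  homology class cannot biject with a field.\<close>

lemma homology_iso_field_0_second_vertex:
  assumes fin: "finite \<Delta>" and iso: "homology_iso_field TYPE('k::field) \<Delta> 0"
  shows "\<exists>v. v \<noteq> y \<and> {v} \<in> \<Delta>"
proof (rule ccontr)
  assume no: "\<not> ?thesis"
  have zero: "z = (\<lambda>_. 0)" if z: "z \<in> cycles \<Delta> 0" for z :: "nat set \<Rightarrow> 'k"
  proof -
    have supp: "F = {y} \<and> F \<in> \<Delta>" if "z F \<noteq> 0" for F
    proof -
      have "F \<in> \<Delta>" "card F = 1" using z that by (auto simp: cycles_def chains_def)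
      then show ?thesis using no by (metis card_1_singletonE)
    qed
    have "z {y} = 0"
    proof (rule ccontr)
      assume nz: "z {y} \<noteq> 0"
      have "boundary \<Delta> z {} = (\<Sum>F\<in>\<Delta>. if F = {y} then z {y} else 0)"
        unfolding boundary_def
      proof (rule sum.cong[OF refl])
        fix F
        show "(\<Sum>v\<in>F. if F - {v} = {} then (-1) ^ card {u\<in>F. u < v} * z F else 0) = (if F = {y} then z {y} else 0)"
        proof (cases "F = {y}")
          case True
          \<comment> \<open>No vertex of \<open>{y}\<close> precedes \<open>y\<close>, so the sign
            in the boundary is +1.\<close>
          have none: "{u. u = y \<and> u < y} = {}" by auto
          show ?thesis using True by (simp add: none)
        next
          case False
          then have "z F = 0" using supp by blast
          then have "(if F - {v} = {} then (-1) ^ card {u\<in>F. u < v} * z F else 0) = 0" for v by simp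
          then show ?thesis using False by (simp only: sum.neutral_const if_False)
        qed
      qed
      also have "\<dots> = z {y}" using fin supp[OF nz] by simp
      finally show False using z nz by (simp add: cycles_def)
    qed
    then show ?thesis using supp by fastforce
  qed
  obtain \<phi> :: "(nat set \<Rightarrow> 'k) set \<Rightarrow> 'k" where "bij_betw \<phi> (reduced_homology \<Delta> 0) UNIV"
    using iso by (auto simp: homology_iso_field_def)
  then obtain X Y where XY: "X \<in> reduced_homology \<Delta> 0" "Y \<in> reduced_homology \<Delta> 0" "\<phi> X = 0" "\<phi> Y = 1"
    by (metis UNIV_I bij_betw_imp_surj_on imageE)
  have "X = Y" using XY(1,2) zero by (auto simp: reduced_homology_def quotient_def)
  then show False using XY by simp
qed

text \<open>The link of a maximal face is \<open>{{}}\<close>, whose homology in degree -1 is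
  nonzero, so the sphere dimension prescribed for this link must be -1.\<close>

lemma homology_sphere_pure:
  assumes "homology_sphere TYPE('k::field) \<Delta>" and F: "F \<in> \<Delta>" and mx: "\<And>G. G \<in> \<Delta> \<Longrightarrow> F \<subseteq> G \<Longrightarrow> G = F"
  shows "card F = facet_card \<Delta>"
proof (rule ccontr)
  assume ne: "card F \<noteq> facet_card \<Delta>"
  have "face_link \<Delta> F = {{}}" using F mx by (auto simp: face_link_def)
  then have "has_homology_of_sphere TYPE('k) {{}} (int (facet_card \<Delta>) - 1 - int (card F))"
    using assms(1) F by (metis homology_sphere_def)
  then have "homology_trivial TYPE('k) {{}} (-1)"
    using ne unfolding has_homology_of_sphere_def by (auto dest!: spec[of _ "-1"] split: if_splits)
  then show False using not_homology_trivial_empty_face by blast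
qed

lemma face_card_le: "simplicial_complex \<Delta> \<Longrightarrow> F \<in> \<Delta> \<Longrightarrow> card F \<le> facet_card \<Delta>"
  using complex_finite by (simp add: facet_card_def)

lemma homology_sphere_facet_exists:
  assumes hs: "homology_sphere TYPE('k::field) \<Delta>" and F: "F \<in> \<Delta>"
  shows "\<exists>G\<in>\<Delta>. F \<subseteq> G \<and> card G = facet_card \<Delta>"
proof -
  have "finite \<Delta>" using hs complex_finite by (auto simp: homology_sphere_def)
  then obtain G where "G \<in> \<Delta>" "F \<subseteq> G" "\<And>H. H \<in> \<Delta> \<Longrightarrow> G \<subseteq> H \<Longrightarrow> H = G"
    using finite_has_maximal2[OF _ F] by metis
  then show ?thesis using homology_sphere_pure[OF hs] by blast
qed

text \<open>The link of the ridge \<open>G - {y}\<close> has the homology of a 0-sphere and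
  therefore a vertex besides \<open>y\<close>.\<close>

lemma homology_sphere_ridge:
  assumes hs: "homology_sphere TYPE('k::field) \<Delta>"
    and G: "G \<in> \<Delta>" "card G = facet_card \<Delta>" and y: "y \<in> G"
  shows "\<exists>x. x \<notin> G \<and> insert x (G - {y}) \<in> \<Delta>"
proof -
  have sc: "simplicial_complex \<Delta>" using hs by (simp add: homology_sphere_def)
  let ?F = "G - {y}"
  have F: "?F \<in> \<Delta>" using complex_subset[OF sc G(1)] by blast
  have "int (facet_card \<Delta>) - 1 - int (card ?F) = 0"
    using G y face_finite[OF sc G(1)] by (simp add: card_Diff_singleton_if) (metis One_nat_def card_gt_0_iff empty_iff of_nat_diff Suc_leI of_nat_1 diff_self)
  then have "homology_iso_field TYPE('k) (face_link \<Delta> ?F) 0"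
    using hs F unfolding homology_sphere_def has_homology_of_sphere_def by metis
  moreover have "finite (face_link \<Delta> ?F)"
    using complex_finite[OF sc] complex_subset[OF sc]
    by (rule_tac finite_subset[of _ \<Delta>]) (auto simp: face_link_def)
  ultimately obtain x where x: "x \<noteq> y" "{x} \<in> face_link \<Delta> ?F"
    using homology_iso_field_0_second_vertex by blast
  then show ?thesis by (auto simp: face_link_def)
qed

text \<open>Under complementation, extending a face to a facet shrinks a transversal to size
  \<open>n - d\<close>, and crossing a ridge to another facet exchanges one of its points.\<close>

lemma homology_sphere_exchange:
  assumes hs: "homology_sphere TYPE('k::field) \<Delta>"
  shows "exchange_hypergraph (vertices \<Delta>) (minimal_nonfaces \<Delta>) (card (vertices \<Delta>) - facet_card \<Delta>)"
proof
  have sc: "simplicial_complex \<Delta>" using hs by (simp add: homology_sphere_def)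
  let ?V = "vertices \<Delta>" and ?E = "minimal_nonfaces \<Delta>" and ?d = "facet_card \<Delta>"
  show finV: "finite ?V" using sc by (simp add: simplicial_complex_def)
  show "M \<subseteq> ?V" if "M \<in> ?E" for M using that by (simp add: minimal_nonfaces_def)
  show "M = L" if "M \<in> ?E" "L \<in> ?E" "M \<subseteq> L" for M L
    using minimal_nonface_antichain[OF sc that] .
  show "M \<noteq> {}" if "M \<in> ?E" for M
    using that sc by (auto simp: minimal_nonfaces_def simplicial_complex_def)
  have cardV: "card ?V = card X + card (?V - X)" if "X \<subseteq> ?V" for X
    using that finV finite_subset[OF that finV] card_mono[OF finV that] by (simp add: card_Diff_subset)
  show "card ?V - ?d \<le> card X" if "X \<subseteq> ?V" "\<forall>M\<in>?E. X \<inter> M \<noteq> {}" for X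
  proof -
    have "?V - X \<in> \<Delta>" using face_iff_transversal[OF sc that(1)] that(2) by simp
    then show ?thesis using face_card_le[OF sc, of "?V - X"] cardV[OF that(1)] by linarith
  qed
  show "\<exists>Y\<subseteq>X. (\<forall>M\<in>?E. Y \<inter> M \<noteq> {}) \<and> card Y = card ?V - ?d"
    if X: "X \<subseteq> ?V" "\<forall>M\<in>?E. X \<inter> M \<noteq> {}" for X
  proof -
    obtain G where G: "G \<in> \<Delta>" "?V - X \<subseteq> G" "card G = ?d"
      using homology_sphere_facet_exists[OF hs] face_iff_transversal[OF sc X(1)] X(2) by metis
    have GV: "G \<subseteq> ?V" using G(1) face_subset_vertices by blast
    then have "?V - (?V - G) = G" by blast
    then have "\<forall>M\<in>?E. (?V - G) \<inter> M \<noteq> {}" using face_iff_transversal[OF sc, of "?V - G"] G(1) by simp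
    moreover have "card (?V - G) = card ?V - ?d" using cardV[OF GV] G(3) by simp
    moreover have "?V - G \<subseteq> X" using G(2) by blast
    ultimately show ?thesis by blast
  qed
  show "\<exists>x\<in>X. \<forall>M\<in>?E. (insert y X - {x}) \<inter> M \<noteq> {}"
    if X: "X \<subseteq> ?V" "\<forall>M\<in>?E. X \<inter> M \<noteq> {}" "card X = card ?V - ?d" and y: "y \<in> ?V - X" for X y
  proof -
    have G: "?V - X \<in> \<Delta>" using face_iff_transversal[OF sc X(1)] X(2) by simp
    \<comment> \<open>Any facet shows \<open>d \<le> n\<close>, so that the subtraction in
      \<open>card X\<close> is not truncated and \<open>?V - X\<close> is itself a facet.\<close>
    obtain H where H: "H \<in> \<Delta>" "card H = ?d" using homology_sphere_facet_exists[OF hs G] by blast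
    have "?d \<le> card ?V" using card_mono[OF finV face_subset_vertices[OF H(1)]] H(2) by simp
    then have "card (?V - X) = ?d" using cardV[OF X(1)] X(3) by linarith
    from homology_sphere_ridge[OF hs G this y]
    obtain x where x: "x \<notin> ?V - X" "insert x (?V - X - {y}) \<in> \<Delta>" by (elim exE conjE)
    have xV: "x \<in> ?V" using face_subset_vertices[OF x(2)] by blast
    have "?V - (insert y X - {x}) = insert x (?V - X - {y})" using x xV by blast
    moreover have "insert y X - {x} \<subseteq> ?V" using X(1) y by blast
    ultimately have "\<forall>M\<in>?E. (insert y X - {x}) \<inter> M \<noteq> {}"
      using face_iff_transversal[OF sc, of "insert y X - {x}"] x(2) by simp
    then show ?thesis using x(1) xV by blast
  qed
qed


section \<open>Isomorphism classes\<close>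

lemma complex_iso_sym:
  assumes "complex_iso \<Delta> \<Gamma>" shows "complex_iso \<Gamma> \<Delta>"
proof -
  obtain f where f: "bij_betw f (vertices \<Delta>) (vertices \<Gamma>)" "(\<lambda>F. f ` F) ` \<Delta> = \<Gamma>"
    using assms by (auto simp: complex_iso_def)
  let ?g = "inv_into (vertices \<Delta>) f"
  have "?g ` (f ` F) = F" if "F \<in> \<Delta>" for F
    using f(1) face_subset_vertices[OF that] by (simp add: bij_betw_def)
  then have "(\<lambda>F. ?g ` F) ` \<Gamma> = \<Delta>" using f(2) by (force simp: image_iff)
  then show ?thesis using bij_betw_inv_into[OF f(1)] by (auto simp: complex_iso_def)
qed

lemma complex_iso_trans:
  assumes "complex_iso \<Delta> \<Gamma>" "complex_iso \<Gamma> \<Theta>" shows "complex_iso \<Delta> \<Theta>"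
proof -
  obtain f g where "bij_betw f (vertices \<Delta>) (vertices \<Gamma>)" "(\<lambda>F. f ` F) ` \<Delta> = \<Gamma>"
    "bij_betw g (vertices \<Gamma>) (vertices \<Theta>)" "(\<lambda>F. g ` F) ` \<Gamma> = \<Theta>"
    using assms by (auto simp: complex_iso_def)
  then have "bij_betw (g \<circ> f) (vertices \<Delta>) (vertices \<Theta>)" "(\<lambda>F. (g \<circ> f) ` F) ` \<Delta> = \<Theta>"
    by (auto simp: bij_betw_trans image_comp image_image)
  then show ?thesis unfolding complex_iso_def by blast
qed

lemma complex_iso_standard_labels:
  assumes "finite (vertices \<Delta>)"
  shows "\<exists>\<Gamma>. complex_iso \<Delta> \<Gamma> \<and> vertices \<Gamma> = {..<card (vertices \<Delta>)}"
proof -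
  obtain f where f: "bij_betw f (vertices \<Delta>) {..<card (vertices \<Delta>)}"
    using ex_bij_betw_finite_nat[OF assms] by (auto simp: atLeast0LessThan)
  have "vertices ((\<lambda>F. f ` F) ` \<Delta>) = f ` vertices \<Delta>" by (auto simp: vertices_def)
  then show ?thesis
    using f by (intro exI[of _ "(\<lambda>F. f ` F) ` \<Delta>"]) (auto simp: complex_iso_def bij_betw_def)
qed

text \<open>Every class is generated by a complex on an initial segment of \<open>{..<B}\<close>.
  This representative may lie outside \<open>A\<close>, since classes are taken among all
  complexes.\<close>

lemma finite_iso_classes:
  assumes "\<And>\<Delta>. \<Delta> \<in> A \<Longrightarrow> finite (vertices \<Delta>) \<and> card (vertices \<Delta>) \<le> B"
  shows "finite (A // {(\<Delta>, \<Gamma>). complex_iso \<Delta> \<Gamma>})"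
proof (rule finite_subset)
  let ?r = "{(\<Delta>, \<Gamma>). complex_iso \<Delta> \<Gamma>}"
  show "A // ?r \<subseteq> (\<lambda>\<Gamma>. ?r `` {\<Gamma>}) ` Pow (Pow {..<B})"
  proof
    fix C assume "C \<in> A // ?r"
    then obtain \<Delta> where \<Delta>: "\<Delta> \<in> A" "C = ?r `` {\<Delta>}" by (auto simp: quotient_def)
    obtain \<Gamma> where \<Gamma>: "complex_iso \<Delta> \<Gamma>" "vertices \<Gamma> = {..<card (vertices \<Delta>)}"
      using complex_iso_standard_labels assms[OF \<Delta>(1)] by blast
    have "vertices \<Gamma> \<subseteq> {..<B}" using \<Gamma>(2) assms[OF \<Delta>(1)] by auto
    then have "\<Gamma> \<in> Pow (Pow {..<B})" using face_subset_vertices by blast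
    moreover have "C = ?r `` {\<Gamma>}"
      using \<Delta>(2) \<Gamma>(1) complex_iso_trans complex_iso_sym by blast
    ultimately show "C \<in> (\<lambda>\<Gamma>. ?r `` {\<Gamma>}) ` Pow (Pow {..<B})" by blast
  qed
qed simp

theorem theorem3p3:
  fixes \<alpha> :: int
  shows "finite ({\<Delta>. homology_sphere TYPE('k::field) \<Delta> \<and> unsuspended \<Delta> \<and> alpha_inv \<Delta> = \<alpha>}
                   // {(\<Delta>, \<Gamma>). complex_iso \<Delta> \<Gamma>})"
proof (rule finite_iso_classes)
  fix \<Delta> assume "\<Delta> \<in> {\<Delta>. homology_sphere TYPE('k) \<Delta> \<and> unsuspended \<Delta> \<and> alpha_inv \<Delta> = \<alpha>}"
  then have hs: "homology_sphere TYPE('k) \<Delta>" and us: "unsuspended \<Delta>" and al: "alpha_inv \<Delta> = \<alpha>" by auto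
  have sc: "simplicial_complex \<Delta>" using hs by (simp add: homology_sphere_def)
  \<comment> \<open>Replacing a negative \<alpha> by 0 only weakens the upper bound on the number of
    minimal non-faces.\<close>
  let ?a = "nat \<alpha>"
  have "card (minimal_nonfaces \<Delta>) \<le> card (vertices \<Delta>) - facet_card \<Delta> + ?a"
    using al unfolding alpha_inv_def by linarith
  then have "card (minimal_nonfaces \<Delta>) \<le> 2 * ?a + 2 * ?a * (2 * ?a)"
    using exchange_hypergraph.card_edges_le[OF homology_sphere_exchange[OF hs]]
      unsuspended_nonface_meets_another[OF sc us] by blast
  then have "(2::nat) ^ card (minimal_nonfaces \<Delta>) \<le> 2 ^ (2 * ?a + 2 * ?a * (2 * ?a))"
    by (rule power_increasing) simp
  with unsuspended_card_vertices_le[OF sc us]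
  have "card (vertices \<Delta>) \<le> 2 ^ (2 * ?a + 2 * ?a * (2 * ?a))" by (rule le_trans)
  then show "finite (vertices \<Delta>) \<and> card (vertices \<Delta>) \<le> 2 ^ (2 * ?a + 2 * ?a * (2 * ?a))"
    using sc by (simp add: simplicial_complex_def)
qed

end
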